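(* Let $H$ be a connected graph in an association scheme that admits vertex PST (resp., vertex PGST), with associated permutation matrix $P$. Let $a\neq b$ and $c\neq d$ be vertices of $H$. Then $H$ admits PST (resp., PGST) between $\mathbf{x}=\mathbf{e}_a+s\,\mathbf{e}_b$ and $\mathbf{y}=\mathbf{e}_c+s\,\mathbf{e}_d$ for all $s\in\mathbb{R}\setminus\{0\}$ if and only if either (i) $\mathbf{e}_c=P\mathbf{e}_a$ and $\mathbf{e}_d=P\mathbf{e}_b$, or (ii) $\mathbf{e}_b=P\mathbf{e}_a$ and $(c,d)=(b,a)$.
   Context: A (symmetric) association scheme is a set $\{A_0,\dots,A_r\}$ of symmetric 0-1 matrices with $A_0=I$, $\sum_j A_j=\mathbf{J}$ (all-ones matrix), and every product $A_iA_j$ in the linear span of the set. A graph is in an association scheme if its adjacency matrix is contained in one. For a graph $H$ with adjacency matrix $A$ let $U_H(t)=\exp(itA)$ (such graphs are regular, so using the Laplacian $\Delta-A$ or signless Laplacian $\Delta+A$, with $\Delta$ the degree matrix, gives the same state transfer properties). $\mathbf{e}_a$ is the characteristic vector of vertex $a$. Nonzero real vectors represent real pure states (normalization omitted). PST (perfect state transfer) between $\mathbf{x}$ and $\mathbf{y}$ at time $\tau>0$ means $U_H(\tau)\mathbf{x}=\gamma\mathbf{y}$ for some $\gamma\in\mathbb{C}$; PGST (pretty good state transfer) means there are a real sequence $(t_k)$ and $\gamma\in\mathbb{C}$ with $\lim_k U_H(t_k)\mathbf{x}=\gamma\mathbf{y}$. Vertex PST (PGST) is PST (PGST) between $\mathbf{e}_a$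 and $\mathbf{e}_c$ for two distinct vertices $a,c$. It is known that if a connected graph $H$ in an association scheme has vertex PST at time $\tau$ (resp., vertex PGST relative to a sequence $(t_k)$), then $U_H(\tau)$ (resp., $\lim_k U_H(t_k)$) is a scalar multiple of a permutation matrix $P$ of order two without fixed points; $P$ is called the permutation matrix associated with $H$. PST/PGST between $\mathbf{x}$ and $\mathbf{y}$ is considered for $(a,b)\neq(c,d)$; the case $(a,b)=(c,d)$ is called periodicity and is not regarded as transfer between two states.
   Formalization: For PGST the associated P can depend on the sequence, and the claim then fails for a single P; so P is assumed to be the only associated permutation matrix, and for every H with vertex PGST the equivalence is also proved with "(i) or (ii) holds for some associated P". *)

theory Defs
  imports "HOL-Analysis.Analysis"
begin

text \<open>Graphs are edge relations on a finite vertex type; matrices over that type are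
  elements of \<open>real ^ 'v ^ 'v\<close> or \<open>complex ^ 'v ^ 'v\<close>.\<close>

definition simple_graph :: "('v \<Rightarrow> 'v \<Rightarrow> bool) \<Rightarrow> bool" where
  "simple_graph H \<longleftrightarrow> symp H \<and> irreflp H"

definition connected_graph :: "('v \<Rightarrow> 'v \<Rightarrow> bool) \<Rightarrow> bool" where
  "connected_graph H \<longleftrightarrow> (\<forall>u v. H\<^sup>*\<^sup>* u v)"

definition adjacency :: "('v::finite \<Rightarrow> 'v \<Rightarrow> bool) \<Rightarrow> real ^ 'v ^ 'v" where
  "adjacency H = (\<chi> u v. if H u v then 1 else 0)"

definition association_scheme :: "(real ^ 'v ^ 'v) set \<Rightarrow> bool" where
  "association_scheme S \<longleftrightarrow>
     finite S \<and> mat 1 \<in> S \<and>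
     (\<forall>M\<in>S. transpose M = M \<and> (\<forall>u v. M $ u $ v \<in> {0, 1})) \<and>
     (\<Sum>M\<in>S. M) = (\<chi> u v. 1) \<and>
     (\<forall>M\<in>S. \<forall>N\<in>S. M ** N \<in> span S)"

definition in_association_scheme :: "('v::finite \<Rightarrow> 'v \<Rightarrow> bool) \<Rightarrow> bool" where
  "in_association_scheme H \<longleftrightarrow> (\<exists>S. association_scheme S \<and> adjacency H \<in> S)"

text \<open>The instances of \<open>(*)\<close> and \<open>(^)\<close> on \<open>vec\<close> are componentwise, so
  the exponential series is written with iterated \<open>(**)\<close>.\<close>

definition mat_exp :: "complex ^ 'n ^ 'n \<Rightarrow> complex ^ 'n ^ 'n" where
  "mat_exp M = (\<Sum>k. (1 / fact k) *\<^sub>R (((**) M ^^ k) (mat 1)))"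

definition transition :: "('v::finite \<Rightarrow> 'v \<Rightarrow> bool) \<Rightarrow> real \<Rightarrow> complex ^ 'v ^ 'v" where
  "transition H t = mat_exp (map_matrix (\<lambda>x. \<i> * of_real t * of_real x) (adjacency H))"

definition cvec :: "real ^ 'n \<Rightarrow> complex ^ 'n" where
  "cvec x = (\<chi> i. of_real (x $ i))"

definition pst_at :: "('v::finite \<Rightarrow> 'v \<Rightarrow> bool) \<Rightarrow> real \<Rightarrow> real ^ 'v \<Rightarrow> real ^ 'v \<Rightarrow> bool" where
  "pst_at H \<tau> x y \<longleftrightarrow> \<tau> > 0 \<and> (\<exists>\<gamma>. transition H \<tau> *v cvec x = \<gamma> *s cvec y)"

definition pst :: "('v::finite \<Rightarrow> 'v \<Rightarrow> bool) \<Rightarrow> real ^ 'v \<Rightarrow> real ^ 'v \<Rightarrow> bool" where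
  "pst H x y \<longleftrightarrow> (\<exists>\<tau>. pst_at H \<tau> x y)"

definition pgst_along ::
  "('v::finite \<Rightarrow> 'v \<Rightarrow> bool) \<Rightarrow> (nat \<Rightarrow> real) \<Rightarrow> real ^ 'v \<Rightarrow> real ^ 'v \<Rightarrow> bool" where
  "pgst_along H t x y \<longleftrightarrow>
     (\<exists>\<gamma>. (\<lambda>k. transition H (t k) *v cvec x) \<longlonglongrightarrow> \<gamma> *s cvec y)"

definition pgst :: "('v::finite \<Rightarrow> 'v \<Rightarrow> bool) \<Rightarrow> real ^ 'v \<Rightarrow> real ^ 'v \<Rightarrow> bool" where
  "pgst H x y \<longleftrightarrow> (\<exists>t. pgst_along H t x y)"

definition vertex_pst_at :: "('v::finite \<Rightarrow> 'v \<Rightarrow> bool) \<Rightarrow> real \<Rightarrow> bool" where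
  "vertex_pst_at H \<tau> \<longleftrightarrow> (\<exists>u v. u \<noteq> v \<and> pst_at H \<tau> (axis u 1) (axis v 1))"

definition vertex_pgst_along :: "('v::finite \<Rightarrow> 'v \<Rightarrow> bool) \<Rightarrow> (nat \<Rightarrow> real) \<Rightarrow> bool" where
  "vertex_pgst_along H t \<longleftrightarrow> (\<exists>u v. u \<noteq> v \<and> pgst_along H t (axis u 1) (axis v 1))"

definition permutation_matrix :: "real ^ 'v ^ 'v \<Rightarrow> bool" where
  "permutation_matrix P \<longleftrightarrow> (\<exists>p. bij p \<and> P = (\<chi> u v. if u = p v then 1 else 0))"

definition order_two_fixed_point_free :: "real ^ 'v ^ 'v \<Rightarrow> bool" where
  "order_two_fixed_point_free P \<longleftrightarrow>
     permutation_matrix P \<and> P \<noteq> mat 1 \<and> P ** P = mat 1 \<and>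
     (\<forall>v. P *v axis v 1 \<noteq> axis v 1)"

definition scalar_mult :: "complex \<Rightarrow> real ^ 'v ^ 'v \<Rightarrow> complex ^ 'v ^ 'v" where
  "scalar_mult \<gamma> P = map_matrix (\<lambda>x. \<gamma> * of_real x) P"

definition pst_permutation :: "('v::finite \<Rightarrow> 'v \<Rightarrow> bool) \<Rightarrow> real ^ 'v ^ 'v \<Rightarrow> bool" where
  "pst_permutation H P \<longleftrightarrow> order_two_fixed_point_free P \<and>
     (\<exists>\<tau>. vertex_pst_at H \<tau> \<and> (\<exists>\<gamma>. transition H \<tau> = scalar_mult \<gamma> P))"

definition pgst_permutation_along ::
  "('v::finite \<Rightarrow> 'v \<Rightarrow> bool) \<Rightarrow> (nat \<Rightarrow> real) \<Rightarrow> real ^ 'v ^ 'v \<Rightarrow> bool" where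
  "pgst_permutation_along H t P \<longleftrightarrow> order_two_fixed_point_free P \<and>
     vertex_pgst_along H t \<and>
     (\<exists>\<gamma>. (\<lambda>k. transition H (t k)) \<longlonglongrightarrow> scalar_mult \<gamma> P)"

text \<open>The matrix in \<open>pst_permutation\<close> does not depend on the time. Its PGST analogue may
  depend on the sequence (pretty good state transfer is not monogamous), so \<open>P\<close> is
  ``the'' permutation matrix associated with \<open>H\<close> only if every such sequence yields \<open>P\<close>.\<close>

definition the_pgst_permutation :: "('v::finite \<Rightarrow> 'v \<Rightarrow> bool) \<Rightarrow> real ^ 'v ^ 'v \<Rightarrow> bool" where
  "the_pgst_permutation H P \<longleftrightarrow> (\<exists>t. pgst_permutation_along H t P) \<and>
     (\<forall>t Q. pgst_permutation_along H t Q \<longrightarrow> Q = P)"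

definition pair_state :: "'v::finite \<Rightarrow> 'v \<Rightarrow> real \<Rightarrow> real ^ 'v" where
  "pair_state a b s = axis a 1 + s *\<^sub>R axis b 1"

end

theory Submission
  imports Defs
begin

text \<open>Every limit \<open>V\<close> of transition matrices is a symmetric unitary matrix whose entries depend only
  on the class of the scheme. Transfer for all \<open>s\<close> and compactness give, for \<open>s \<longlongrightarrow> 0\<close>, such a limit
  sending \<open>e_a\<close> to a multiple of \<open>e_c\<close>; since every class meets every column, it is a multiple of an
  involution \<open>p\<close> lying in the scheme. In the same way \<open>s \<longlongrightarrow> \<infinity>\<close> yields an involution \<open>q\<close> with
  \<open>q b = d\<close>. If \<open>p \<noteq> q\<close>, comparing the entries in rows \<open>c\<close>, \<open>d\<close>, \<open>p b\<close>, \<open>q a\<close> of the transfer equation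
  for the single value \<open>s = 2\<close> is contradictory. For PST the involution is unique, because the times at
  which the transition matrix is a scalar form a discrete subgroup of the reals. Case (ii) of the
  theorem is contained in case (i), as \<open>P\<close> is an involution.\<close>

subsection \<open>Association schemes\<close>

text \<open>Stands in for membership in the complex span of the scheme. It is a closed condition on
  entries, so it passes to limits, and the free entry type covers real and complex matrices
  alike.\<close>

definition class_constant :: "(real ^ 'n ^ 'n) set \<Rightarrow> 'b ^ 'n ^ 'n \<Rightarrow> bool" where
  "class_constant S V \<longleftrightarrow>
     (\<forall>M\<in>S. \<forall>u v u' v'. M $ u $ v = 1 \<longrightarrow> M $ u' $ v' = 1 \<longrightarrow> V $ u $ v = V $ u' $ v')"

lemma class_constantD:
  "class_constant S V \<Longrightarrow> M \<in> S \<Longrightarrow> M $ u $ v = 1 \<Longrightarrow> M $ u' $ v' = 1 \<Longrightarrow> V $ u $ v = V $ u' $ v'"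
  unfolding class_constant_def by blast

section \<open>Permutation matrices as functions on the vertices\<close>

definition perm_mat :: "('n \<Rightarrow> 'n) \<Rightarrow> real ^ 'n ^ 'n" where
  "perm_mat p = (\<chi> u v. if u = p v then 1 else 0)"

lemma perm_mat_nth [simp]: "perm_mat p $ u $ v = (if u = p v then 1 else 0)"
  by (simp add: perm_mat_def)

lemma perm_mat_mult_axis: "perm_mat p *v axis v 1 = axis (p v) (1::real)"
  by (simp add: vec_eq_iff matrix_vector_mult_def axis_def mult_delta_right)

lemma axis_eq_perm_mat_mult_iff: "axis u 1 = perm_mat p *v axis v (1::real) \<longleftrightarrow> u = p v"
  by (simp add: perm_mat_mult_axis axis_eq_axis)

lemma perm_mat_mult: "perm_mat p ** perm_mat q = perm_mat (p \<circ> q)"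
  by (simp add: vec_eq_iff matrix_matrix_mult_def mult_delta_right)

lemma perm_mat_eq_iff: "perm_mat p = perm_mat q \<longleftrightarrow> p = q"
proof
  assume eq: "perm_mat p = perm_mat q"
  have "p v = q v" for v
    using axis_eq_perm_mat_mult_iff[of "p v" q v] axis_eq_perm_mat_mult_iff[of "p v" p v] eq by simp
  then show "p = q" by blast
qed simp

lemma perm_mat_id: "perm_mat id = mat 1"
  by (simp add: vec_eq_iff mat_def)

lemma order_two_fixed_point_free_iff:
  "order_two_fixed_point_free P \<longleftrightarrow> (\<exists>p. P = perm_mat p \<and> (\<forall>v. p (p v) = v \<and> p v \<noteq> v))"
proof
  assume P: "order_two_fixed_point_free P"
  then obtain p where p: "P = perm_mat p"
    by (auto simp: order_two_fixed_point_free_def permutation_matrix_def perm_mat_def)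
  have "perm_mat (p \<circ> p) = perm_mat id"
    using P by (simp add: order_two_fixed_point_free_def p perm_mat_mult perm_mat_id)
  then have "p (p v) = v" for v
    by (simp add: perm_mat_eq_iff fun_eq_iff)
  moreover have "p v \<noteq> v" for v
    using P by (simp add: order_two_fixed_point_free_def p perm_mat_mult_axis axis_eq_axis)
  ultimately show "\<exists>p. P = perm_mat p \<and> (\<forall>v. p (p v) = v \<and> p v \<noteq> v)"
    using p by blast
next
  assume "\<exists>p. P = perm_mat p \<and> (\<forall>v. p (p v) = v \<and> p v \<noteq> v)"
  then obtain p where p: "P = perm_mat p" "\<And>v. p (p v) = v" "\<And>v. p v \<noteq> v" by blast
  have "bij p" by (rule o_bij[of p]) (auto simp: p)
  moreover have "perm_mat p \<noteq> mat 1"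
    using p(3) unfolding perm_mat_id[symmetric] perm_mat_eq_iff by (auto simp: fun_eq_iff)
  moreover have "p \<circ> p = id" by (auto simp: p)
  ultimately show "order_two_fixed_point_free P"
    using p by (auto simp: order_two_fixed_point_free_def permutation_matrix_def p(1) perm_mat_mult
        perm_mat_id perm_mat_mult_axis axis_eq_axis) (auto simp: perm_mat_def)
qed

section \<open>Classes of a scheme and the matrices constant on them\<close>

locale scheme =
  fixes S :: "(real ^ 'v::finite ^ 'v) set"
  assumes scheme: "association_scheme S"
begin

lemma entry_cases: "M \<in> S \<Longrightarrow> M $ u $ v = 0 \<or> M $ u $ v = 1"
  using scheme by (auto simp: association_scheme_def)

lemma entry_commute:
  assumes "M \<in> S" shows "M $ u $ v = M $ v $ u"
proof -
  have "transpose M = M" using scheme assms by (auto simp: association_scheme_def)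
  then have "transpose M $ v $ u = M $ v $ u" by simp
  then show ?thesis by (simp add: transpose_def)
qed

lemma finite_scheme: "finite S" and mat_1_in: "mat 1 \<in> S"
  using scheme by (auto simp: association_scheme_def)

lemma sum_entries: "(\<Sum>M\<in>S. M $ u $ v) = 1"
proof -
  have "(\<Sum>M\<in>S. M) $ u $ v = 1"
    using scheme by (simp add: association_scheme_def)
  then show ?thesis by simp
qed

lemma class_exists: obtains M where "M \<in> S" "M $ u $ v = 1"
proof -
  have "\<exists>M\<in>S. M $ u $ v \<noteq> 0"
    using sum_entries[of u v] by (metis (no_types, lifting) sum.neutral zero_neq_one)
  then show ?thesis using entry_cases that by blast
qed

text \<open>Entries are nonnegative and sum to 1 over the scheme, so two distinct members cannot
  both contribute a one at the same position.\<close>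

lemma class_unique:
  assumes "M \<in> S" "N \<in> S" "M $ u $ v = 1" "N $ u $ v = 1"
  shows "M = N"
proof (rule ccontr)
  assume "M \<noteq> N"
  then have "(\<Sum>L\<in>{M, N}. L $ u $ v) = 2" using assms by simp
  moreover have "(\<Sum>L\<in>{M, N}. L $ u $ v) \<le> (\<Sum>L\<in>S. L $ u $ v)"
  proof (rule sum_mono2)
    show "0 \<le> L $ u $ v" if "L \<in> S - {M, N}" for L
      using entry_cases[of L u v] that by auto
  qed (use assms finite_scheme in auto)
  ultimately show False by (simp add: sum_entries)
qed

lemma class_constant_member: "N \<in> S \<Longrightarrow> class_constant S N"
  unfolding class_constant_def by (metis class_unique entry_cases)

lemma class_constant_span: "N \<in> span S \<Longrightarrow> class_constant S N"
proof (induction rule: span_induct_alt)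
  case base
  then show ?case by (simp add: class_constant_def)
next
  case (step c x y)
  have "class_constant S x" using class_constant_member step by blast
  with step show ?case
    unfolding class_constant_def vector_add_component vector_scaleR_component by metis
qed

lemma mult_span: "M \<in> S \<Longrightarrow> N \<in> S \<Longrightarrow> M ** N \<in> span S"
  using scheme by (auto simp: association_scheme_def)

lemma mult_span_right:
  assumes "M \<in> S" "N \<in> span S" shows "M ** N \<in> span S"
  using assms(2)
proof (induction rule: span_induct_alt)
  case base
  then show ?case by (simp add: span_zero)
next
  case (step c x y)
  have "M ** (c *\<^sub>R x + y) = c *\<^sub>R (M ** x) + M ** y"
    by (simp add: vec_eq_iff matrix_matrix_mult_def sum_distrib_left sum.distrib algebra_simps)
  then show ?case using step mult_span[OF assms(1)] by (simp add: span_add span_scale)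
qed

lemma power_span: "M \<in> S \<Longrightarrow> ((**) M ^^ k) (mat 1) \<in> span S"
  by (induction k) (auto simp: mult_span_right mat_1_in span_base)

lemma class_constant_commute: "class_constant S V \<Longrightarrow> V $ u $ v = V $ v $ u"
  by (metis class_constantD class_exists entry_commute)

lemma class_constant_diagonal: "class_constant S V \<Longrightarrow> V $ u $ u = V $ v $ v"
  by (rule class_constantD[OF _ mat_1_in]) (auto simp: mat_def)

text \<open>The diagonal of \<open>M ** M\<close> is constant and counts the ones in the columns of \<open>M\<close>.\<close>
lemma class_meets_column:
  assumes "M \<in> S" "M $ u $ v = 1"
  shows "\<exists>k. M $ k $ w = 1"
proof (rule ccontr)
  assume "\<not> ?thesis"
  then have "M $ k $ w = 0" for k using entry_cases[OF assms(1)] by blast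
  then have "(M ** M) $ w $ w = 0" by (simp add: matrix_matrix_mult_def)
  then have "(M ** M) $ v $ v = 0"
    using class_constant_diagonal[OF class_constant_span[OF mult_span[OF assms(1,1)]]] by metis
  then have "(\<Sum>k\<in>UNIV. M $ v $ k * M $ k $ v) = 0" by (simp add: matrix_matrix_mult_def)
  moreover have "0 \<le> M $ v $ k * M $ k $ v" for k
    using entry_cases[OF assms(1), of k v] entry_cases[OF assms(1), of v k] by auto
  ultimately have "M $ v $ u * M $ u $ v = 0"
    by (subst (asm) sum_nonneg_eq_0_iff) auto
  then show False using assms entry_commute[of M u v] by simp
qed

text \<open>\<open>V\<close> is a complex combination of the members \<open>M\<close> of the scheme,
  so the product is the same combination of the matrices \<open>M ** N\<close>, which lie in the
  span and are therefore class constant.\<close>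

lemma class_constant_mult:
  fixes V :: "complex ^ 'v ^ 'v"
  assumes V: "class_constant S V" and N: "N \<in> S"
  shows "class_constant S (V ** map_matrix of_real N)"
proof -
  \<comment> \<open>\<open>c M\<close> is the common value of \<open>V\<close> on the ones of
    \<open>M\<close>. If \<open>M\<close> has no ones the choice is arbitrary, and harmless because
    its term below vanishes.\<close>
  define c where "c M = (SOME x. \<forall>u v. M $ u $ v = 1 \<longrightarrow> V $ u $ v = x)" for M :: "real ^ 'v ^ 'v"
  have c: "V $ u $ v = c M" if "M \<in> S" "M $ u $ v = 1" for M u v
  proof -
    have "\<forall>u' v'. M $ u' $ v' = 1 \<longrightarrow> V $ u' $ v' = V $ u $ v"
      using class_constantD[OF V] that by metis
    then have "\<forall>u' v'. M $ u' $ v' = 1 \<longrightarrow> V $ u' $ v' = c M"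
      unfolding c_def by (rule someI)
    then show ?thesis using that by blast
  qed
  have dec: "V $ u $ v = (\<Sum>M\<in>S. c M * of_real (M $ u $ v))" for u v
  proof -
    obtain M where M: "M \<in> S" "M $ u $ v = 1" by (rule class_exists)
    have "(\<Sum>L\<in>S. c L * of_real (L $ u $ v)) = (\<Sum>L\<in>S. if L = M then c M else 0)"
      using M entry_cases class_unique by (intro sum.cong) force+
    then show ?thesis using M finite_scheme c by simp
  qed
  have eq: "(V ** map_matrix of_real N) $ u $ v = (\<Sum>M\<in>S. c M * of_real ((M ** N) $ u $ v))" for u v
  proof -
    have "(V ** map_matrix of_real N) $ u $ v
        = (\<Sum>w\<in>UNIV. \<Sum>M\<in>S. c M * of_real (M $ u $ w) * of_real (N $ w $ v))"
      by (simp add: matrix_matrix_mult_def dec[of u] sum_distrib_right)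
    also have "\<dots> = (\<Sum>M\<in>S. \<Sum>w\<in>UNIV. c M * of_real (M $ u $ w) * of_real (N $ w $ v))"
      by (rule sum.swap)
    finally show ?thesis
      by (simp add: matrix_matrix_mult_def sum_distrib_left mult.assoc)
  qed
  show ?thesis
    unfolding class_constant_def eq
    by (intro ballI allI impI sum.cong refl)
      (metis N class_constantD class_constant_span mult_span)
qed

text \<open>Right multiplication by \<open>perm_mat q\<close> permutes columns: the product has
  entry \<open>V $ u $ q v\<close> at \<open>(u, v)\<close>, and it is again class constant.\<close>

lemma class_constant_shift:
  fixes V :: "complex ^ 'v ^ 'v"
  assumes V: "class_constant S V" and q: "perm_mat q \<in> S"
    and M: "M \<in> S" "M $ u $ v = 1" "M $ u' $ v' = 1"
  shows "V $ u $ q v = V $ u' $ q v'"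
proof -
  have "(V ** map_matrix of_real (perm_mat q)) $ u $ v = V $ u $ q v" for u v
    by (simp add: matrix_matrix_mult_def if_distrib[of complex_of_real] mult_delta_right
        cong: if_cong)
  then show ?thesis
    using class_constantD[OF class_constant_mult[OF V q] M] by simp
qed

lemma class_constant_shift_commute:
  fixes V :: "complex ^ 'v ^ 'v"
  assumes "class_constant S V" and "perm_mat q \<in> S"
  shows "V $ u $ q v = V $ v $ q u"
  using assms class_constant_shift by (metis class_exists entry_commute)

lemma class_constant_shift_diagonal:
  fixes V :: "complex ^ 'v ^ 'v"
  assumes "class_constant S V" and "perm_mat q \<in> S"
  shows "V $ u $ q u = V $ v $ q v"
  by (rule class_constant_shift[OF assms mat_1_in]) (auto simp: mat_def)

text \<open>Every class meets column \<open>a\<close>, so \<open>V\<close> vanishes off the class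
  \<open>M\<close> of \<open>(c, a)\<close> and equals \<gamma> on it. Unitarity gives all columns
  of \<open>M\<close> equally many ones, hence one each as in column \<open>a\<close>. Symmetry of
  \<open>M\<close> makes \<open>q\<close> an involution, and the constant diagonal of
  \<open>M\<close> is all ones or all zeros.\<close>

lemma scalar_permutation_of_column:
  fixes V :: "complex ^ 'v ^ 'v"
  assumes V: "class_constant S V" and \<gamma>: "\<gamma> \<noteq> 0"
    and col: "\<And>k. V $ k $ a = (if k = c then \<gamma> else 0)"
    and cols: "\<And>u v. (\<Sum>w\<in>UNIV. V $ u $ w * cnj (V $ w $ v)) = (if u = v then 1 else 0)"
  obtains q where "perm_mat q \<in> S" "V = scalar_mult \<gamma> (perm_mat q)" "q a = c"
    "\<And>v. q (q v) = v" "q = id \<or> (\<forall>v. q v \<noteq> v)"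
proof -
  obtain M where M: "M \<in> S" "M $ c $ a = 1" by (rule class_exists)
  have entry: "V $ u $ v = \<gamma> * of_real (M $ u $ v)" for u v
  proof -
    obtain N where N: "N \<in> S" "N $ u $ v = 1" by (rule class_exists)
    obtain k where k: "N $ k $ a = 1" using class_meets_column[OF N] by blast
    have Vuv: "V $ u $ v = V $ k $ a" using class_constantD[OF V N k] .
    show ?thesis
    proof (cases "k = c")
      case True
      then have "N = M" using class_unique N M k by blast
      then show ?thesis using Vuv col N True by simp
    next
      case False
      have "M $ u $ v \<noteq> 1"
      proof
        assume "M $ u $ v = 1"
        then have "V $ u $ v = V $ c $ a" using class_constantD[OF V M(1)] M(2) by blast
        then show False using Vuv col False \<gamma> by simp
      qed
      then show ?thesis using Vuv col False entry_cases[OF M(1)] by fastforce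
    qed
  qed
  have sq: "(\<Sum>w\<in>UNIV. M $ w $ v) = (1::real) / (cmod \<gamma>)\<^sup>2" for v
  proof -
    have "(\<Sum>w\<in>UNIV. V $ v $ w * cnj (V $ w $ v)) = of_real ((cmod \<gamma>)\<^sup>2 * (\<Sum>w\<in>UNIV. M $ w $ v))"
    proof -
      have "V $ v $ w * cnj (V $ w $ v) = of_real ((cmod \<gamma>)\<^sup>2 * M $ w $ v)" for w
        using entry_cases[OF M(1), of w v] entry_commute[OF M(1), of v w]
        by (auto simp: entry complex_norm_square[symmetric])
      then show ?thesis by (simp add: sum_distrib_left)
    qed
    then have "(cmod \<gamma>)\<^sup>2 * (\<Sum>w\<in>UNIV. M $ w $ v) = 1"
      using cols[of v v] by (metis of_real_eq_1_iff)
    then show ?thesis using \<gamma> by (simp add: field_simps)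
  qed
  have col_a: "M $ k $ a = (if k = c then 1 else 0)" for k
    using entry[of k a] col[of k] \<gamma> by (auto split: if_splits)
  \<comment> \<open>Comparison with column \<open>a\<close>, whose only one is in row
    \<open>c\<close>, fixes the modulus of \<gamma> and with it every column sum.\<close>
  have sum1: "(\<Sum>w\<in>UNIV. M $ w $ v) = 1" for v
    using sq[of v] sq[of a] by (simp add: col_a)
  have ex1: "\<exists>k. \<forall>w. M $ w $ v = (if w = k then 1 else 0)" for v
  proof -
    obtain k where k: "M $ k $ v = 1" using class_meets_column[OF M] by blast
    have "M $ w $ v = 0" if "w \<noteq> k" for w
    proof -
      have "(\<Sum>w\<in>UNIV - {k}. M $ w $ v) = 0"
        using sum1[of v] k by (simp add: sum_diff1)
      moreover have "0 \<le> M $ w $ v" for w using entry_cases[OF M(1), of w v] by auto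
      ultimately show ?thesis using that by (subst (asm) sum_nonneg_eq_0_iff) auto
    qed
    then show ?thesis using k by auto
  qed
  then obtain q where q: "\<And>v w. M $ w $ v = (if w = q v then 1 else 0)" by metis
  have Mq: "M = perm_mat q" by (simp add: vec_eq_iff q)
  show thesis
  proof (rule that)
    show "perm_mat q \<in> S" using M Mq by simp
    show "V = scalar_mult \<gamma> (perm_mat q)"
      by (simp add: vec_eq_iff scalar_mult_def map_matrix_def entry Mq)
    show "q a = c" using M(2) q by (metis zero_neq_one)
    show qq: "q (q v) = v" for v
      using entry_commute[OF M(1), of v "q v"] by (simp add: q split: if_splits)
    show "q = id \<or> (\<forall>v. q v \<noteq> v)"
      using class_constant_diagonal[OF class_constant_member[OF M(1)]]
      by (auto simp: fun_eq_iff q) (metis zero_neq_one)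
  qed
qed

end

subsection \<open>Transition matrices\<close>

text \<open>Entries count walks of length \<open>k\<close>. The powers are kept real so that they
  lie in the span of the scheme.\<close>

definition walks :: "('v::finite \<Rightarrow> 'v \<Rightarrow> bool) \<Rightarrow> nat \<Rightarrow> real ^ 'v ^ 'v" where
  "walks H k = ((**) (adjacency H) ^^ k) (mat 1)"

lemma walks_add: "walks H (i + j) = walks H i ** walks H j"
  by (induction i) (simp_all add: walks_def matrix_mul_assoc)

lemma abs_walks_le: "\<bar>walks H k $ u $ v\<bar> \<le> real CARD('v) ^ k"
  for H :: "'v::finite \<Rightarrow> 'v \<Rightarrow> bool"
proof (induction k arbitrary: u)
  case 0
  then show ?case by (simp add: walks_def mat_def)
next
  case (Suc k)
  have "\<bar>walks H (Suc k) $ u $ v\<bar> = \<bar>\<Sum>w\<in>UNIV. adjacency H $ u $ w * walks H k $ w $ v\<bar>"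
    by (simp add: walks_def matrix_matrix_mult_def)
  also have "\<dots> \<le> (\<Sum>w\<in>(UNIV :: 'v set). real CARD('v) ^ k)"
    using Suc by (intro order_trans[OF sum_abs] sum_mono) (auto simp: adjacency_def abs_mult)
  finally show ?case by simp
qed

lemma scaled_walks:
  "((**) (map_matrix (\<lambda>x. z * of_real x) (adjacency H)) ^^ k) (mat 1) $ u $ v
     = (z::complex) ^ k * of_real (walks H k $ u $ v)"
proof (induction k arbitrary: u)
  case 0
  then show ?case by (simp add: walks_def mat_def)
next
  case (Suc k)
  then show ?case
    by (simp add: walks_def matrix_matrix_mult_def sum_distrib_left mult_ac)
qed

lemma summable_walks:
  "summable (\<lambda>k. norm ((z ^ k /\<^sub>R fact k) * complex_of_real (walks H k $ u $ v)))"
  for H :: "'v::finite \<Rightarrow> 'v \<Rightarrow> bool"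
proof (rule summable_comparison_test'[OF summable_exp_generic[of "norm z * real CARD('v)"]])
  fix k
  show "norm (norm ((z ^ k /\<^sub>R fact k) * complex_of_real (walks H k $ u $ v)))
      \<le> (norm z * real CARD('v)) ^ k /\<^sub>R fact k"
    using mult_left_mono[OF abs_walks_le[of H k u v], of "norm z ^ k / fact k"]
    by (simp add: norm_mult norm_power power_mult_distrib divide_simps)
qed

text \<open>Convergence of all entries implies convergence of the matrix series, so the infinite sum
  in \<open>mat_exp\<close> is a true limit and can be read off entry by entry.\<close>

lemma transition_sums:
  "(\<lambda>k. ((\<i> * of_real t) ^ k /\<^sub>R fact k) * of_real (walks H k $ u $ v)) sums (transition H t $ u $ v)"
proof -
  let ?f = "\<lambda>k. (1 / fact k) *\<^sub>R
    ((**) (map_matrix (\<lambda>x. \<i> * of_real t * of_real x) (adjacency H)) ^^ k) (mat 1)"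
  have f: "?f k $ u $ v = ((\<i> * of_real t) ^ k /\<^sub>R fact k) * of_real (walks H k $ u $ v)" for k u v
    by (simp add: scaled_walks divide_inverse)
  have "?f sums (\<chi> u v. \<Sum>k. ?f k $ u $ v)"
    unfolding sums_def
  proof (intro vec_tendstoI)
    fix u v
    have "(\<lambda>k. ?f k $ u $ v) sums (\<Sum>k. ?f k $ u $ v)"
      unfolding f by (intro summable_sums summable_norm_cancel[OF summable_walks])
    then show "(\<lambda>n. (\<Sum>k<n. ?f k) $ u $ v) \<longlonglongrightarrow> (\<chi> u v. \<Sum>k. ?f k $ u $ v) $ u $ v"
      by (simp add: sums_def)
  qed
  then have "transition H t = (\<chi> u v. \<Sum>k. ?f k $ u $ v)"
    unfolding transition_def mat_exp_def by (rule sums_unique[symmetric])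
  then have eq: "transition H t $ u $ v = (\<Sum>k. ?f k $ u $ v)" by simp
  show ?thesis
    unfolding eq f by (rule summable_sums[OF summable_norm_cancel[OF summable_walks]])
qed

section \<open>The one-parameter group of transition matrices\<close>

lemma transition_0: "transition H 0 = mat 1"
proof -
  have "transition H 0 $ u $ v = mat 1 $ u $ v" for u v
  proof -
    have "(\<lambda>k. ((\<i> * of_real 0) ^ k /\<^sub>R fact k) * complex_of_real (walks H k $ u $ v)) sums
        (\<Sum>k\<in>{0}. ((\<i> * of_real 0) ^ k /\<^sub>R fact k) * of_real (walks H k $ u $ v))"
      by (rule sums_finite) auto
    from sums_unique2[OF transition_sums this] show ?thesis
      by (simp add: walks_def mat_def)
  qed
  then show ?thesis by (simp add: vec_eq_iff)
qed

text \<open>For fixed \<open>w\<close> the two entry series are multiplied as a Cauchy product.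
  Summing over \<open>w\<close> joins walks of lengths \<open>i\<close> and \<open>k - i\<close>
  into walks of length \<open>k\<close>; the sum over \<open>i\<close> is then the binomial identity
  for exponential terms.\<close>

lemma transition_add: "transition H (s + t) = transition H s ** transition H t"
proof -
  let ?S = "\<lambda>t k. (\<i> * complex_of_real t) ^ k /\<^sub>R fact k"
  let ?W = "\<lambda>k u v. complex_of_real (walks H k $ u $ v)"
  have "transition H (s + t) $ u $ v = (transition H s ** transition H t) $ u $ v" for u v
  proof -
    have "(\<lambda>k. \<Sum>i\<le>k. (?S s i * ?W i u w) * (?S t (k - i) * ?W (k - i) w v)) sums
        (transition H s $ u $ w * transition H t $ w $ v)" for w
      using Cauchy_product_sums[OF summable_walks[of "\<i> * of_real s" H u w] summable_walks[of "\<i> * of_real t" H w v]]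
      by (simp only: sums_unique[OF transition_sums, symmetric])
    then have "(\<lambda>k. \<Sum>w\<in>UNIV. \<Sum>i\<le>k. (?S s i * ?W i u w) * (?S t (k - i) * ?W (k - i) w v)) sums
        (\<Sum>w\<in>UNIV. transition H s $ u $ w * transition H t $ w $ v)"
      by (intro sums_sum) auto
    moreover have "(\<Sum>w\<in>UNIV. \<Sum>i\<le>k. (?S s i * ?W i u w) * (?S t (k - i) * ?W (k - i) w v))
        = ?S (s + t) k * ?W k u v" for k
    proof -
      have "(\<Sum>w\<in>UNIV. \<Sum>i\<le>k. (?S s i * ?W i u w) * (?S t (k - i) * ?W (k - i) w v))
          = (\<Sum>i\<le>k. \<Sum>w\<in>UNIV. (?S s i * ?W i u w) * (?S t (k - i) * ?W (k - i) w v))"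
        by (rule sum.swap)
      also have "\<dots> = (\<Sum>i\<le>k. ?S s i * ?S t (k - i) * ?W k u v)"
      proof (rule sum.cong[OF refl])
        fix i assume "i \<in> {..k}"
        then have "walks H k = walks H i ** walks H (k - i)" using walks_add[of H i "k - i"] by simp
        then have "?W k u v = (\<Sum>w\<in>UNIV. ?W i u w * ?W (k - i) w v)"
          by (simp add: matrix_matrix_mult_def)
        then show "(\<Sum>w\<in>UNIV. (?S s i * ?W i u w) * (?S t (k - i) * ?W (k - i) w v))
            = ?S s i * ?S t (k - i) * ?W k u v"
          by (simp add: sum_distrib_left mult_ac flip: scaleR_sum_right)
      qed
      also have "\<dots> = (\<Sum>i\<le>k. ?S s i * ?S t (k - i)) * ?W k u v"
        by (simp add: sum_distrib_right)
      also have "(\<Sum>i\<le>k. ?S s i * ?S t (k - i)) = ?S (s + t) k"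
        using exp_series_add_commuting[of "\<i> * complex_of_real s" "\<i> * of_real t" k]
        by (simp add: distrib_left mult.commute)
      finally show ?thesis .
    qed
    ultimately have "(\<lambda>k. ?S (s + t) k * ?W k u v) sums
        (\<Sum>w\<in>UNIV. transition H s $ u $ w * transition H t $ w $ v)"
      by (simp only:)
    then show ?thesis
      using sums_unique2[OF transition_sums[of "s + t" H u v]] by (simp only: matrix_matrix_mult_def vec_lambda_beta)
  qed
  then show ?thesis by (simp add: vec_eq_iff)
qed

lemma cnj_transition: "cnj (transition H t $ u $ v) = transition H (- t) $ u $ v"
proof -
  have "(\<lambda>k. cnj (((\<i> * of_real t) ^ k /\<^sub>R fact k) * of_real (walks H k $ u $ v))) sums
      cnj (transition H t $ u $ v)"
    by (rule iffD2[OF sums_cnj transition_sums])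
  then have "(\<lambda>k. ((\<i> * of_real (- t)) ^ k /\<^sub>R fact k) * of_real (walks H k $ u $ v)) sums
      cnj (transition H t $ u $ v)"
    by simp
  then show ?thesis
    by (rule sums_unique2[OF _ transition_sums])
qed

text \<open>The inverse \<open>transition H (- t)\<close> is the entrywise conjugate. No transpose
  occurs here; combined with symmetry the identity says that rows are orthonormal.\<close>

lemma transition_unitary:
  "(\<Sum>w\<in>UNIV. transition H t $ u $ w * cnj (transition H t $ w $ v)) = (if u = v then 1 else 0)"
proof -
  have "(transition H t ** transition H (- t)) $ u $ v = mat 1 $ u $ v"
    by (simp add: transition_0 flip: transition_add)
  then show ?thesis by (simp add: cnj_transition matrix_matrix_mult_def mat_def)
qed

lemma continuous_transition: "continuous_on UNIV (\<lambda>t. transition H t $ u $ v)"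
proof -
  have "transition H t $ u $ v
      = (\<Sum>k. (of_real (walks H k $ u $ v) / fact k) * (\<i> * of_real t) ^ k)" for t
    using sums_unique[OF transition_sums[of t H u v]] by (simp add: scaleR_conv_of_real field_simps)
  moreover have "isCont (\<lambda>z. \<Sum>k. (complex_of_real (walks H k $ u $ v) / fact k) * z ^ k) z" for z
  proof (rule isCont_powser_converges_everywhere)
    show "summable (\<lambda>k. (complex_of_real (walks H k $ u $ v) / fact k) * y ^ k)" for y
      using summable_norm_cancel[OF summable_walks[of y H u v]]
      by (simp add: scaleR_conv_of_real field_simps)
  qed
  then have "continuous_on UNIV (\<lambda>z. \<Sum>k. (complex_of_real (walks H k $ u $ v) / fact k) * z ^ k)"
    by (simp add: continuous_on_eq_continuous_at)
  then have "continuous_on UNIV ((\<lambda>z. \<Sum>k. (complex_of_real (walks H k $ u $ v) / fact k) * z ^ k)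
      \<circ> (\<lambda>t::real. \<i> * of_real t))"
    by (intro continuous_on_compose) (auto intro!: continuous_intros elim: continuous_on_subset)
  ultimately show ?thesis by (simp add: o_def)
qed

text \<open>The powers of the adjacency matrix lie in the span of the scheme, so the exponential
  series of two entries in the same class agree term by term.\<close>

lemma (in scheme) class_constant_transition:
  assumes "adjacency H \<in> S"
  shows "class_constant S (transition H t)"
  unfolding class_constant_def
proof (intro ballI allI impI)
  fix M u v u' v' assume M: "M \<in> S" "M $ u $ v = 1" "M $ u' $ v' = 1"
  have "walks H k $ u $ v = walks H k $ u' $ v'" for k
    using class_constantD[OF class_constant_span[OF power_span[OF assms]] M] by (simp add: walks_def)
  then show "transition H t $ u $ v = transition H t $ u' $ v'"
    using sums_unique2[OF transition_sums[of t H u v]] transition_sums[of t H u' v'] by simp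
qed

subsection \<open>Limits of transition matrices\<close>

lemma mult_cvec_pair_state:
  "(V *v cvec (pair_state a b s)) $ k = V $ k $ a + of_real s * V $ k $ b"
proof -
  have "(V *v cvec (pair_state a b s)) $ k = (\<Sum>j\<in>UNIV. (if j = a then V $ k $ j else 0)
      + (if j = b then of_real s * V $ k $ j else 0))"
    unfolding matrix_vector_mult_def vec_lambda_beta
    by (rule sum.cong) (auto simp: cvec_def pair_state_def axis_def algebra_simps)
  then show ?thesis by (simp add: sum.distrib)
qed

lemma mult_cvec_axis: "(V *v cvec (axis a 1)) $ k = V $ k $ a"
  by (simp add: matrix_vector_mult_def cvec_def axis_def if_distrib[of complex_of_real] mult_delta_right
      cong: if_cong)

lemma cvec_pair_state_nth:
  "cvec (pair_state c d s) $ k = of_bool (k = c) + of_real s * of_bool (k = d)"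
  by (simp add: cvec_def pair_state_def axis_def)

lemma cvec_axis_nth: "cvec (axis c 1) $ k = of_bool (k = c)"
  by (simp add: cvec_def axis_def)

lemma scalar_mult_perm_mat_nth: "scalar_mult \<gamma> (perm_mat p) $ u $ v = \<gamma> * of_bool (u = p v)"
  by (simp add: scalar_mult_def)

lemma scalar_mult_perm_mat_pair_state:
  "scalar_mult \<gamma> (perm_mat p) *v cvec (pair_state a b s) = \<gamma> *s cvec (pair_state (p a) (p b) s)"
  by (simp add: vec_eq_iff mult_cvec_pair_state cvec_pair_state_nth scalar_mult_perm_mat_nth algebra_simps)

lemma scalar_mult_perm_mat_axis:
  "scalar_mult \<gamma> (perm_mat p) *v cvec (axis a 1) = \<gamma> *s cvec (axis (p a) 1)"
  by (simp add: vec_eq_iff mult_cvec_axis cvec_axis_nth scalar_mult_perm_mat_nth)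

lemma tendsto_matrix_vector_mult:
  fixes M :: "'b \<Rightarrow> complex ^ 'n ^ 'm"
  assumes "(M \<longlongrightarrow> L) F"
  shows "((\<lambda>k. M k *v x) \<longlongrightarrow> L *v x) F"
proof (rule vec_tendstoI)
  fix i
  have "((\<lambda>k. \<Sum>j\<in>UNIV. M k $ i $ j * x $ j) \<longlongrightarrow> (\<Sum>j\<in>UNIV. L $ i $ j * x $ j)) F"
    using assms by (intro tendsto_intros) auto
  then show "((\<lambda>k. (M k *v x) $ i) \<longlongrightarrow> (L *v x) $ i) F"
    by (simp add: matrix_vector_mult_def)
qed

text \<open>Its points are exactly the limits of transition matrices along sequences of times, which
  makes compactness available.\<close>

abbreviation transition_closure :: "('v::finite \<Rightarrow> 'v \<Rightarrow> bool) \<Rightarrow> (complex ^ 'v ^ 'v) set" where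
  "transition_closure H \<equiv> closure (range (transition H))"

lemma transition_closureE:
  assumes "V \<in> transition_closure H"
  obtains t where "(\<lambda>k. transition H (t k)) \<longlonglongrightarrow> V"
proof -
  obtain f where f: "\<And>k. f k \<in> range (transition H)" "f \<longlonglongrightarrow> V"
    using assms unfolding closure_sequential by blast
  then have "\<forall>k. \<exists>t. f k = transition H t" by blast
  then obtain t where "\<And>k. f k = transition H (t k)" by metis
  then have "f = (\<lambda>k. transition H (t k))" by blast
  then show thesis using f that by blast
qed

lemma transition_closureI:
  assumes "(\<lambda>k. transition H (t k)) \<longlonglongrightarrow> V"
  shows "V \<in> transition_closure H"
  unfolding closure_sequential
  by (rule exI[of _ "\<lambda>k. transition H (t k)"]) (simp add: assms)

lemma transition_closure_unitary:
  assumes "V \<in> transition_closure H"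
  shows "(\<Sum>w\<in>UNIV. V $ u $ w * cnj (V $ w $ v)) = (if u = v then 1 else 0)"
proof -
  obtain t where t: "(\<lambda>k. transition H (t k)) \<longlonglongrightarrow> V"
    using assms by (rule transition_closureE)
  have "(\<lambda>k. \<Sum>w\<in>UNIV. transition H (t k) $ u $ w * cnj (transition H (t k) $ w $ v))
      \<longlonglongrightarrow> (\<Sum>w\<in>UNIV. V $ u $ w * cnj (V $ w $ v))"
    using t by (intro tendsto_intros) auto
  then show ?thesis unfolding transition_unitary by (simp add: LIMSEQ_const_iff)
qed

lemma pgst_of_closure:
  assumes "scalar_mult \<gamma> (perm_mat p) \<in> transition_closure H"
  shows "pgst H (pair_state a b s) (pair_state (p a) (p b) s)"
proof -
  obtain t where "(\<lambda>k. transition H (t k)) \<longlonglongrightarrow> scalar_mult \<gamma> (perm_mat p)"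
    using assms by (rule transition_closureE)
  from tendsto_matrix_vector_mult[OF this, of "cvec (pair_state a b s)"] show ?thesis
    unfolding pgst_def pgst_along_def scalar_mult_perm_mat_pair_state by blast
qed

text \<open>The transfer equation in entries, for an arbitrary matrix so that it applies to limits,
  and with the scalar exposed because its modulus matters.\<close>

definition transfers :: "complex ^ 'v::finite ^ 'v \<Rightarrow> complex \<Rightarrow> 'v \<Rightarrow> 'v \<Rightarrow> 'v \<Rightarrow> 'v \<Rightarrow> real \<Rightarrow> bool" where
  "transfers V \<gamma> a b c d s \<longleftrightarrow>
     (\<forall>k. V $ k $ a + of_real s * V $ k $ b = \<gamma> * (of_bool (k = c) + of_real s * of_bool (k = d)))"

lemma transfers_iff:
  "transfers V \<gamma> a b c d s \<longleftrightarrow> V *v cvec (pair_state a b s) = \<gamma> *s cvec (pair_state c d s)"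
  by (simp add: transfers_def vec_eq_iff mult_cvec_pair_state cvec_pair_state_nth)

text \<open>\<open>pair_state a b (1 / s)\<close> is \<open>1 / s\<close> times
  \<open>pair_state b a s\<close>, so large parameters become small ones after exchanging the
  vertices of each pair.\<close>

lemma transfers_swap:
  assumes "transfers V \<gamma> a b c d (1 / s)" and "s \<noteq> 0"
  shows "transfers V \<gamma> b a d c s"
  unfolding transfers_def
proof
  fix k
  have "of_real s * (V $ k $ a + of_real (1 / s) * V $ k $ b)
      = of_real s * (\<gamma> * (of_bool (k = c) + of_real (1 / s) * of_bool (k = d)))"
    using assms(1) unfolding transfers_def by metis
  then show "V $ k $ b + of_real s * V $ k $ a
      = \<gamma> * (of_bool (k = d) + of_real s * of_bool (k = c))"
    using assms(2) by (simp add: algebra_simps)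
qed

lemma pgst_permutation_of_closure:
  fixes q :: "'v::finite \<Rightarrow> 'v"
  assumes "scalar_mult \<gamma> (perm_mat q) \<in> transition_closure H"
    and q: "\<And>v. q (q v) = v" "\<And>v. q v \<noteq> v"
  shows "\<exists>t. pgst_permutation_along H t (perm_mat q)"
proof -
  obtain t where t: "(\<lambda>k. transition H (t k)) \<longlonglongrightarrow> scalar_mult \<gamma> (perm_mat q)"
    using assms(1) by (rule transition_closureE)
  have "pgst_along H t (axis v 1) (axis (q v) 1)" for v
    using tendsto_matrix_vector_mult[OF t, of "cvec (axis v 1)"]
    unfolding pgst_along_def scalar_mult_perm_mat_axis by blast
  then have "vertex_pgst_along H t"
    unfolding vertex_pgst_along_def using q(2) by metis
  then show ?thesis
    using t q unfolding pgst_permutation_along_def order_two_fixed_point_free_iff by blast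
qed

section \<open>Limits of transition matrices for a graph in a scheme\<close>

locale scheme_graph = scheme S for S :: "(real ^ 'v::finite ^ 'v) set" +
  fixes H :: "'v \<Rightarrow> 'v \<Rightarrow> bool"
  assumes adjacency_in: "adjacency H \<in> S"
begin

lemmas class_constant_U = class_constant_transition[OF adjacency_in]

lemma class_constant_closure:
  assumes "V \<in> transition_closure H"
  shows "class_constant S V"
  unfolding class_constant_def
proof (intro ballI allI impI)
  fix M u v u' v' assume M: "M \<in> S" "M $ u $ v = 1" "M $ u' $ v' = 1"
  obtain t where t: "(\<lambda>k. transition H (t k)) \<longlonglongrightarrow> V"
    using assms by (rule transition_closureE)
  have "(\<lambda>k. transition H (t k) $ u $ v) \<longlonglongrightarrow> V $ u $ v"
    and "(\<lambda>k. transition H (t k) $ u' $ v') \<longlonglongrightarrow> V $ u' $ v'"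
    using t by (auto intro!: tendsto_intros)
  then show "V $ u $ v = V $ u' $ v'"
    using class_constantD[OF class_constant_U M] LIMSEQ_unique by simp
qed

lemma closure_symmetric: "V \<in> transition_closure H \<Longrightarrow> V $ u $ v = V $ v $ u"
  by (rule class_constant_commute[OF class_constant_closure])

lemma norm_transition_entry: "norm (transition H t $ u $ v) \<le> 1"
proof -
  have "(\<Sum>w\<in>UNIV. transition H t $ u $ w * cnj (transition H t $ u $ w)) = 1"
    using transition_unitary[of H t u u] class_constant_commute[OF class_constant_U[of t], of u] by simp
  then have "complex_of_real (\<Sum>w\<in>UNIV. (norm (transition H t $ u $ w))\<^sup>2) = 1"
    by (simp add: complex_norm_square del: of_real_power)
  then have "(\<Sum>w\<in>UNIV. (norm (transition H t $ u $ w))\<^sup>2) = 1"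
    using of_real_eq_1_iff by blast
  then have "(norm (transition H t $ u $ v))\<^sup>2 \<le> 1"
    using member_le_sum[of v UNIV "\<lambda>w. (norm (transition H t $ u $ w))\<^sup>2"] by simp
  then show ?thesis by (simp add: power_le_one_iff)
qed

lemma compact_transition_closure: "compact (transition_closure H)"
proof -
  have "norm (transition H t) \<le> real CARD('v) * real CARD('v)" for t
  proof -
    have "norm (transition H t $ u) \<le> real CARD('v)" for u
      unfolding norm_vec_def[of "transition H t $ u"]
      by (rule order_trans[OF L2_set_le_sum])
        (use sum_bounded_above[of "UNIV :: 'v set" _ "1::real"] norm_transition_entry in auto)
    then show ?thesis
      unfolding norm_vec_def[of "transition H t"]
      by (intro order_trans[OF L2_set_le_sum])
        (use sum_bounded_above[of "UNIV :: 'v set" _ "real CARD('v)"] in auto)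
  qed
  then show ?thesis unfolding compact_closure bounded_iff by blast
qed

text \<open>PGST gives convergence on one vector only. Compactness yields a subsequence along which
  the whole matrix converges.\<close>

lemma pgst_imp_closure:
  assumes "pgst H x y"
  obtains V \<gamma> where "V \<in> transition_closure H" "V *v cvec x = \<gamma> *s cvec y"
proof -
  obtain t \<gamma> where t: "(\<lambda>k. transition H (t k) *v cvec x) \<longlonglongrightarrow> \<gamma> *s cvec y"
    using assms unfolding pgst_def pgst_along_def by blast
  have "\<forall>k. transition H (t k) \<in> transition_closure H"
    using closure_subset[of "range (transition H)"] by auto
  with compact_transition_closure obtain V r where V: "V \<in> transition_closure H" "strict_mono r"
    "((\<lambda>k. transition H (t k)) \<circ> r) \<longlonglongrightarrow> V"
    unfolding compact_eq_seq_compact_metric by (rule seq_compactE)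
  have "(\<lambda>k. transition H (t (r k)) *v cvec x) \<longlonglongrightarrow> V *v cvec x"
    using tendsto_matrix_vector_mult[OF V(3)] by (simp add: o_def)
  moreover have "(\<lambda>k. transition H (t (r k)) *v cvec x) \<longlonglongrightarrow> \<gamma> *s cvec y"
    using LIMSEQ_subseq_LIMSEQ[OF t V(2)] by (simp add: o_def)
  ultimately show thesis using that V(1) LIMSEQ_unique by blast
qed

text \<open>The entrywise conjugate of \<open>V\<close> is its inverse, so transfer from x to y
  gives \<open>cnj \<gamma>\<close> times V y = x. By symmetry the pairing of y with V x equals that
  of x with V y. As x and y both have squared norm \<open>1 + s * s\<close>, \<gamma> has modulus 1,
  and the second claim is the entry at \<open>a\<close> of V y = \<gamma> x.\<close>

lemma transfers_reverse:
  assumes V: "V \<in> transition_closure H" and tr: "transfers V \<gamma> a b c d s"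
    and "a \<noteq> b" "c \<noteq> d"
  shows "norm \<gamma> = 1" "V $ a $ c + of_real s * V $ a $ d = \<gamma>"
proof -
  have reverse: "cnj \<gamma> * (V $ j $ c + of_real s * V $ j $ d)
      = of_bool (j = a) + of_real s * of_bool (j = b)" for j
  proof -
    have "(\<Sum>k\<in>UNIV. V $ j $ k * cnj (V $ k $ a + of_real s * V $ k $ b))
        = (\<Sum>k\<in>UNIV. V $ j $ k * cnj (V $ k $ a)) + of_real s * (\<Sum>k\<in>UNIV. V $ j $ k * cnj (V $ k $ b))"
      by (simp add: algebra_simps sum.distrib sum_distrib_left)
    also have "\<dots> = of_bool (j = a) + of_real s * of_bool (j = b)"
      by (simp add: transition_closure_unitary[OF V])
    finally have "of_bool (j = a) + of_real s * of_bool (j = b)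
        = (\<Sum>k\<in>UNIV. V $ j $ k * cnj (V $ k $ a + of_real s * V $ k $ b))" ..
    also have "\<dots> = (\<Sum>k\<in>UNIV. V $ j $ k * cnj (\<gamma> * (of_bool (k = c) + of_real s * of_bool (k = d))))"
      using tr unfolding transfers_def by (simp only:)
    also have "\<dots> = (\<Sum>k\<in>UNIV. (if k = c then cnj \<gamma> * V $ j $ k else 0)
        + (if k = d then cnj \<gamma> * of_real s * V $ j $ k else 0))"
      by (rule sum.cong) (auto simp: algebra_simps)
    also have "\<dots> = cnj \<gamma> * (V $ j $ c + of_real s * V $ j $ d)"
      by (simp add: sum.distrib algebra_simps)
    finally show ?thesis ..
  qed
  \<comment> \<open>The pairing of y with V x, rewritten by symmetry as the pairing of x with V
    y.\<close>
  have "\<gamma> * (1 + of_real s * of_real s)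
      = (V $ c $ a + of_real s * V $ c $ b) + of_real s * (V $ d $ a + of_real s * V $ d $ b)"
    using tr \<open>c \<noteq> d\<close> by (simp add: transfers_def algebra_simps)
  also have "\<dots> = (V $ a $ c + of_real s * V $ a $ d) + of_real s * (V $ b $ c + of_real s * V $ b $ d)"
    using closure_symmetric[OF V] by (simp add: algebra_simps)
  finally have "cnj \<gamma> * (\<gamma> * (1 + of_real s * of_real s))
      = cnj \<gamma> * (V $ a $ c + of_real s * V $ a $ d) + of_real s * (cnj \<gamma> * (V $ b $ c + of_real s * V $ b $ d))"
    by (simp only:) (simp add: algebra_simps)
  then have "cnj \<gamma> * (\<gamma> * (1 + of_real s * of_real s)) = 1 + of_real s * of_real s"
    unfolding reverse using \<open>a \<noteq> b\<close> by simp
  moreover have "1 + complex_of_real s * of_real s \<noteq> 0"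
  proof -
    have "1 + s * s \<noteq> 0" by (metis add_nonneg_pos add.commute less_irrefl zero_less_one zero_le_square)
    then show ?thesis by (metis of_real_1 of_real_add of_real_eq_0_iff of_real_mult)
  qed
  ultimately have one: "\<gamma> * cnj \<gamma> = 1" by (simp add: mult.commute)
  then show "norm \<gamma> = 1"
    by (metis complex_mod_cnj norm_mult norm_one norm_ge_zero power2_eq_square power2_eq_1_iff
        abs_of_nonneg one_neq_neg_one abs_1 abs_neg_one)
  show "V $ a $ c + of_real s * V $ a $ d = \<gamma>"
    using arg_cong[OF reverse[of a], of "\<lambda>z. \<gamma> * z"] one \<open>a \<noteq> b\<close> by (simp flip: mult.assoc)
qed

text \<open>Along a subsequence with \<open>s\<close> tending to 0 both the matrices and the scalars
  converge, and the terms with \<open>b\<close> and \<open>d\<close> drop out of the transfer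
  equation.\<close>

lemma concentrated_column_of_transfers:
  assumes tr: "\<And>s. s \<noteq> 0 \<Longrightarrow> \<exists>V\<in>transition_closure H. \<exists>\<gamma>. transfers V \<gamma> a b c d s"
    and "a \<noteq> b" "c \<noteq> d"
  obtains V \<gamma> where "V \<in> transition_closure H" "\<gamma> \<noteq> 0"
    "\<And>k. V $ k $ a = (if k = c then \<gamma> else 0)"
proof -
  define s where "s n = inverse (real (Suc n))" for n
  have s0: "s n \<noteq> 0" for n unfolding s_def by simp
  have slim: "s \<longlonglongrightarrow> 0" unfolding s_def by (rule LIMSEQ_inverse_real_of_nat)
  obtain V \<gamma> where V: "\<And>n. V n \<in> transition_closure H" and tr': "\<And>n. transfers (V n) (\<gamma> n) a b c d (s n)"
    using tr[OF s0] by metis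
  \<comment> \<open>Unit modulus makes the scalars range over a compact set and keeps their limit
    nonzero.\<close>
  have "\<gamma> n \<in> sphere 0 1" for n
    using transfers_reverse(1)[OF V tr' assms(2,3)] by simp
  with V have mem: "\<forall>n. (V n, \<gamma> n) \<in> transition_closure H \<times> sphere 0 1" by blast
  have "compact (transition_closure H \<times> sphere (0::complex) 1)"
    by (intro compact_Times compact_transition_closure compact_sphere)
  then have "seq_compact (transition_closure H \<times> sphere (0::complex) 1)"
    by (simp add: compact_eq_seq_compact_metric)
  then obtain l r where l: "l \<in> transition_closure H \<times> sphere (0::complex) 1" "strict_mono r"
    "((\<lambda>n. (V n, \<gamma> n)) \<circ> r) \<longlonglongrightarrow> l"
    using mem by (rule seq_compactE)
  have Vl: "(\<lambda>n. V (r n)) \<longlonglongrightarrow> fst l" and gl: "(\<lambda>n. \<gamma> (r n)) \<longlonglongrightarrow> snd l"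
    using tendsto_fst[OF l(3)] tendsto_snd[OF l(3)] by (auto simp: o_def)
  have sl: "(\<lambda>n. s (r n)) \<longlonglongrightarrow> 0"
    using LIMSEQ_subseq_LIMSEQ[OF slim l(2)] by (simp add: o_def)
  have "fst l $ k $ a = (if k = c then snd l else 0)" for k
  proof -
    have "(\<lambda>n. V (r n) $ k $ a + of_real (s (r n)) * V (r n) $ k $ b)
        \<longlonglongrightarrow> fst l $ k $ a + of_real 0 * fst l $ k $ b"
      by (intro tendsto_intros Vl sl)
    moreover have "(\<lambda>n. \<gamma> (r n) * (of_bool (k = c) + of_real (s (r n)) * of_bool (k = d)))
        \<longlonglongrightarrow> snd l * (of_bool (k = c) + of_real 0 * of_bool (k = d))"
      by (intro tendsto_intros gl sl)
    ultimately show ?thesis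
      using tr' LIMSEQ_unique unfolding transfers_def by fastforce
  qed
  moreover have "fst l \<in> transition_closure H" "snd l \<noteq> 0"
    using l(1) by (auto simp: mem_Times_iff)
  ultimately show thesis using that by blast
qed

lemma transfer_permutation:
  assumes tr: "\<And>s. s \<noteq> 0 \<Longrightarrow> \<exists>V\<in>transition_closure H. \<exists>\<gamma>. transfers V \<gamma> a b c d s"
    and ab: "a \<noteq> b" and cd: "c \<noteq> d" and "(a, b) \<noteq> (c, d)"
  obtains q \<gamma> where "scalar_mult \<gamma> (perm_mat q) \<in> transition_closure H" "q a = c" "q b = d"
    "\<And>v. q (q v) = v" "\<And>v. q v \<noteq> v"
proof -
  obtain V1 \<gamma>1 where V1: "V1 \<in> transition_closure H" "\<gamma>1 \<noteq> 0"
    "\<And>k. V1 $ k $ a = (if k = c then \<gamma>1 else 0)"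
    using concentrated_column_of_transfers[OF tr ab cd] by blast
  obtain p where p: "perm_mat p \<in> S" "V1 = scalar_mult \<gamma>1 (perm_mat p)" "p a = c"
    "\<And>v. p (p v) = v" "p = id \<or> (\<forall>v. p v \<noteq> v)"
    using scalar_permutation_of_column[OF class_constant_closure[OF V1(1)] V1(2,3)
        transition_closure_unitary[OF V1(1)]] by blast
  have tr': "\<exists>V\<in>transition_closure H. \<exists>\<gamma>. transfers V \<gamma> b a d c s" if s: "s \<noteq> 0" for s
  proof -
    obtain V \<gamma> where "V \<in> transition_closure H" "transfers V \<gamma> a b c d (1 / s)"
      using tr[of "1 / s"] s by auto
    then show ?thesis using transfers_swap s by blast
  qed
  obtain V2 \<gamma>2 where V2: "V2 \<in> transition_closure H" "\<gamma>2 \<noteq> 0"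
    "\<And>k. V2 $ k $ b = (if k = d then \<gamma>2 else 0)"
    using concentrated_column_of_transfers[OF tr'] ab cd by metis
  obtain q where q: "perm_mat q \<in> S" "q b = d" "\<And>v. q (q v) = v"
    using scalar_permutation_of_column[OF class_constant_closure[OF V2(1)] V2(2,3)
        transition_closure_unitary[OF V2(1)]] by blast
  have "p = q"
  proof (rule ccontr)
    assume "p \<noteq> q"
    \<comment> \<open>Distinct classes share no ones, so \<open>p\<close> and \<open>q\<close> agree
      at no vertex.\<close>
    then have pq: "p v \<noteq> q v" for v
      using class_unique[OF p(1) q(1), of "p v" v] by (auto simp: perm_mat_eq_iff)
    \<comment> \<open>For a general parameter \<open>s\<close> the equations below give
      \<open>(1 - s^2) * V $ a $ c = \<gamma>\<close>,
      \<open>(1 - s^2) * V $ a $ d = s * \<gamma>\<close> and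
      \<open>V $ a $ c + s * V $ a $ d = \<gamma>\<close>, hence
      \<open>2 * s^2 * \<gamma> = 0\<close>. Any nonzero \<open>s\<close> leads to the
      contradiction; 2 is a convenient value.\<close>
    obtain V \<gamma> where V: "V \<in> transition_closure H" and t: "transfers V \<gamma> a b c d 2"
      using tr[of 2] by auto
    note sym = closure_symmetric[OF V]
    note shift = class_constant_shift_commute[OF class_constant_closure[OF V]]
    note diag = class_constant_shift_diagonal[OF class_constant_closure[OF V]]
    have row: "V $ a $ k + 2 * V $ b $ k = \<gamma> * (of_bool (k = c) + 2 * of_bool (k = d))" for k
    proof -
      have "V $ k $ a + of_real 2 * V $ k $ b = \<gamma> * (of_bool (k = c) + of_real 2 * of_bool (k = d))"
        using t unfolding transfers_def by blast
      then show ?thesis by (simp add: sym[of k a] sym[of k b])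
    qed
    \<comment> \<open>The rows \<open>p b\<close> and \<open>q a\<close> avoid \<open>c\<close> and
      \<open>d\<close>, since \<open>p\<close> and \<open>q\<close> are injective and disagree at
      \<open>a\<close> and \<open>b\<close>. The right-hand side vanishes in these rows.\<close>
    have "p b \<noteq> c" "q a \<noteq> d" using p q ab by metis+
    moreover have "p b \<noteq> d" "q a \<noteq> c" using pq p(3) q(2) by metis+
    ultimately have "V $ a $ p b + 2 * V $ b $ p b = 0" "V $ a $ q a + 2 * V $ b $ q a = 0"
      using row by simp_all
    \<comment> \<open>\<open>V $ a $ p b = V $ b $ p a = V $ b $ c\<close> and
      \<open>V $ b $ p b = V $ a $ p a = V $ a $ c\<close>; likewise for \<open>q\<close>, with
      \<open>q b = d\<close>.\<close>
    then have "V $ b $ c + 2 * V $ a $ c = 0" "V $ b $ d + 2 * V $ a $ d = 0"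
      using shift[OF p(1), of a b] diag[OF p(1), of b a] shift[OF q(1), of b a] diag[OF q(1), of a b]
      by (simp_all add: p(3) q(2))
    moreover have "V $ a $ c + 2 * V $ b $ c = \<gamma>" "V $ a $ d + 2 * V $ b $ d = 2 * \<gamma>"
      using row[of c] row[of d] cd by simp_all
    moreover have "V $ a $ c + 2 * V $ a $ d = \<gamma>"
      using transfers_reverse(2)[OF V t ab cd] by simp
    ultimately have "\<gamma> = 0" by algebra
    then show False using transfers_reverse(1)[OF V t ab cd] by simp
  qed
  \<comment> \<open>The identity would give \<open>(a, b) = (c, d)\<close>; the only alternative
    left for \<open>p\<close> is to have no fixed points.\<close>
  moreover have "p \<noteq> id"
    using \<open>p = q\<close> p(3) q(2) \<open>(a, b) \<noteq> (c, d)\<close> by auto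
  ultimately show thesis using that p q V1(1) by metis
qed

text \<open>A single limit that is a multiple of an involution serves all \<open>s\<close> at once.
  \<open>Q\<close> is quantified because different sequences may have different matrices.\<close>

lemma pgst_pair_states_iff:
  assumes "a \<noteq> b" "c \<noteq> d" "(a, b) \<noteq> (c, d)"
  shows "(\<forall>s. s \<noteq> 0 \<longrightarrow> pgst H (pair_state a b s) (pair_state c d s)) \<longleftrightarrow>
    (\<exists>t Q. pgst_permutation_along H t Q \<and> axis c 1 = Q *v axis a 1 \<and> axis d 1 = Q *v axis b 1)"
proof
  assume "\<forall>s. s \<noteq> 0 \<longrightarrow> pgst H (pair_state a b s) (pair_state c d s)"
  then have tr: "\<exists>V\<in>transition_closure H. \<exists>\<gamma>. transfers V \<gamma> a b c d s" if "s \<noteq> 0" for s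
    using pgst_imp_closure[of "pair_state a b s" "pair_state c d s"] that
    unfolding transfers_iff by blast
  obtain \<gamma> q where q: "scalar_mult \<gamma> (perm_mat q) \<in> transition_closure H" "q a = c" "q b = d"
    "\<And>v. q (q v) = v" "\<And>v. q v \<noteq> v"
    using transfer_permutation[OF tr assms] by blast
  obtain t where "pgst_permutation_along H t (perm_mat q)"
    using pgst_permutation_of_closure[OF q(1,4,5)] by blast
  then show "\<exists>t Q. pgst_permutation_along H t Q \<and> axis c 1 = Q *v axis a 1 \<and> axis d 1 = Q *v axis b 1"
    using q(2,3) by (intro exI[of _ t] exI[of _ "perm_mat q"]) (simp add: perm_mat_mult_axis)
next
  assume "\<exists>t Q. pgst_permutation_along H t Q \<and> axis c 1 = Q *v axis a 1 \<and> axis d 1 = Q *v axis b 1"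
  then obtain t q \<gamma> where "(\<lambda>k. transition H (t k)) \<longlonglongrightarrow> scalar_mult \<gamma> (perm_mat q)" "c = q a" "d = q b"
    unfolding pgst_permutation_along_def order_two_fixed_point_free_iff
    by (auto simp: axis_eq_perm_mat_mult_iff)
  then show "\<forall>s. s \<noteq> 0 \<longrightarrow> pgst H (pair_state a b s) (pair_state c d s)"
    using pgst_of_closure[OF transition_closureI] by blast
qed

end

subsection \<open>Uniqueness of the involution for perfect state transfer\<close>

text \<open>Arbitrarily small positive elements would make the closed subgroup contain
  \<open>x\<close>. Hence there is a least positive element, and division with remainder shows that
  it generates.\<close>

lemma closed_real_subgroup_cyclic:
  fixes T :: "real set"
  assumes "closed T" and add: "\<And>x y. x \<in> T \<Longrightarrow> y \<in> T \<Longrightarrow> x + y \<in> T"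
    and minus: "\<And>x. x \<in> T \<Longrightarrow> - x \<in> T"
    and y: "y \<in> T" "y \<noteq> 0" and x: "x \<notin> T"
  obtains \<sigma> where "\<sigma> > 0" "T = range (\<lambda>n::int. of_int n * \<sigma>)"
proof -
  have zero: "0 \<in> T" using add[OF y(1) minus[OF y(1)]] by simp
  have nat_mult: "of_nat n * z \<in> T" if "z \<in> T" for n :: nat and z
    by (induction n) (use add that zero in \<open>auto simp: distrib_right\<close>)
  have mult: "of_int n * z \<in> T" if "z \<in> T" for n :: int and z
    using nat_mult[OF that] minus by (cases n rule: int_cases2) fastforce+
  have abs_y: "\<bar>y\<bar> \<in> T" using y(1) minus by (auto simp: abs_if)
  have "\<exists>\<epsilon>>0. \<forall>z\<in>T. z > 0 \<longrightarrow> \<epsilon> \<le> z"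
  proof (rule ccontr)
    assume "\<not> ?thesis"
    then have small: "\<exists>z\<in>T. 0 < z \<and> z < e" if "e > 0" for e
      using that by (meson not_le)
    have "\<exists>z\<in>T. dist z x < e" if e: "e > 0" for e
    proof -
      obtain z where z: "z \<in> T" "0 < z" "z < e" using small[OF e] by blast
      have "dist (of_int \<lfloor>x / z\<rfloor> * z) x < e"
        using floor_divide_lower[OF z(2), of x] floor_divide_upper[OF z(2), of x] z(3)
        by (simp add: dist_real_def algebra_simps)
      then show ?thesis using mult[OF z(1)] by blast
    qed
    then have "x \<in> closure T" by (simp add: closure_approachable)
    then show False using x \<open>closed T\<close> by simp
  qed
  then obtain \<epsilon> where \<epsilon>: "\<epsilon> > 0" "\<And>z. z \<in> T \<Longrightarrow> z > 0 \<Longrightarrow> \<epsilon> \<le> z" by blast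
  have "compact (T \<inter> {\<epsilon>..\<bar>y\<bar>})" using \<open>closed T\<close> by (simp add: closed_Int_compact)
  moreover have "\<bar>y\<bar> \<in> T \<inter> {\<epsilon>..\<bar>y\<bar>}" using abs_y \<epsilon>(2)[OF abs_y] y(2) by simp
  ultimately obtain \<sigma> where min: "\<sigma> \<in> T \<inter> {\<epsilon>..\<bar>y\<bar>}" "\<forall>z\<in>T \<inter> {\<epsilon>..\<bar>y\<bar>}. \<sigma> \<le> z"
    using compact_attains_inf[of "T \<inter> {\<epsilon>..\<bar>y\<bar>}"] by blast
  then have \<sigma>: "\<sigma> \<in> T" "\<epsilon> \<le> \<sigma>" "\<sigma> \<le> \<bar>y\<bar>"
    and least: "\<And>z. z \<in> T \<Longrightarrow> \<epsilon> \<le> z \<Longrightarrow> z \<le> \<bar>y\<bar> \<Longrightarrow> \<sigma> \<le> z"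
    by auto
  have \<sigma>0: "\<sigma> > 0" using \<sigma>(2) \<epsilon>(1) by simp
  have "z \<in> range (\<lambda>n::int. of_int n * \<sigma>)" if z: "z \<in> T" for z
  proof -
    define r where "r = z - of_int \<lfloor>z / \<sigma>\<rfloor> * \<sigma>"
    have "r \<in> T" using add[OF z minus[OF mult[OF \<sigma>(1)]]] by (simp add: r_def)
    moreover have "0 \<le> r" "r < \<sigma>"
      using floor_divide_lower[OF \<sigma>0, of z] floor_divide_upper[OF \<sigma>0, of z]
      by (auto simp: r_def algebra_simps)
    ultimately have "r = 0" using \<epsilon>(2)[of r] least[of r] \<sigma>(3) by force
    then show ?thesis by (auto simp: r_def)
  qed
  then have "T = range (\<lambda>n::int. of_int n * \<sigma>)" using mult[OF \<sigma>(1)] by auto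
  then show thesis using that \<sigma>0 by blast
qed

text \<open>Membership asks for a diagonal matrix only; for a graph in a scheme the diagonal is
  constant and the matrix is a scalar.\<close>

definition scalar_times :: "('v::finite \<Rightarrow> 'v \<Rightarrow> bool) \<Rightarrow> real set" where
  "scalar_times H = {t. \<forall>u v. u \<noteq> v \<longrightarrow> transition H t $ u $ v = 0}"

lemma scalar_timesD: "t \<in> scalar_times H \<Longrightarrow> u \<noteq> v \<Longrightarrow> transition H t $ u $ v = 0"
  by (simp add: scalar_times_def)

lemma transition_add_nth:
  "transition H (s + t) $ u $ v = (\<Sum>w\<in>UNIV. transition H s $ u $ w * transition H t $ w $ v)"
  by (simp add: transition_add matrix_matrix_mult_def)

lemma closed_scalar_times: "closed (scalar_times H)"
  unfolding scalar_times_def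
  by (intro closed_Collect_all closed_Collect_imp open_Collect_const closed_Collect_eq
      continuous_transition continuous_on_const)

lemma zero_in_scalar_times: "0 \<in> scalar_times H"
  by (simp add: scalar_times_def transition_0 mat_def)

lemma scalar_times_add:
  assumes "s \<in> scalar_times H" "t \<in> scalar_times H"
  shows "s + t \<in> scalar_times H"
proof -
  have "transition H s $ u $ w * transition H t $ w $ v = 0" if "u \<noteq> v" for u v w
    using that scalar_timesD[OF assms(1), of u w] scalar_timesD[OF assms(2), of w v] by (cases "u = w") auto
  then show ?thesis
    unfolding scalar_times_def mem_Collect_eq transition_add_nth by (intro allI impI sum.neutral ballI) blast
qed

lemma scalar_times_minus: "t \<in> scalar_times H \<Longrightarrow> - t \<in> scalar_times H"
  by (simp add: scalar_times_def flip: cnj_transition)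

text \<open>A diagonal transition matrix has diagonal entries of modulus 1, so multiplying by it
  rescales each row by a unit.\<close>

lemma norm_transition_shift:
  assumes "s \<in> scalar_times H"
  shows "norm (transition H (s + t) $ u $ v) = norm (transition H t $ u $ v)"
proof -
  have diag: "(\<Sum>w\<in>UNIV. transition H s $ u $ w * f w) = transition H s $ u $ u * f u" for f
  proof -
    have "(\<Sum>w\<in>UNIV. transition H s $ u $ w * f w)
        = (\<Sum>w\<in>UNIV. if w = u then transition H s $ u $ u * f u else 0)"
      using scalar_timesD[OF assms] by (intro sum.cong) auto
    then show ?thesis by simp
  qed
  have "transition H s $ u $ u * cnj (transition H s $ u $ u) = 1"
    using transition_unitary[of H s u u] unfolding diag by simp
  then have "complex_of_real ((norm (transition H s $ u $ u))\<^sup>2) = 1"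
    by (simp only: complex_norm_square)
  then have "(norm (transition H s $ u $ u))\<^sup>2 = 1"
    using of_real_eq_1_iff by blast
  then have "norm (transition H s $ u $ u) = 1"
    by (metis abs_1 abs_norm_cancel power2_eq_iff abs_minus_cancel one_power2)
  then show ?thesis unfolding transition_add_nth diag by (simp add: norm_mult)
qed

text \<open>Only moduli are assumed, as these are what a shift by a scalar time preserves. The
  matrix is not diagonal because \<open>p\<close> has no fixed points, but its square is because
  \<open>p\<close> is an involution.\<close>

lemma permutation_time:
  assumes U: "\<And>u v. norm (transition H t $ u $ v) = c * of_bool (u = p v)"
    and p: "\<And>v. p (p v) = v" "\<And>v. p v \<noteq> v"
  shows "c \<noteq> 0" "t \<notin> scalar_times H" "t + t \<in> scalar_times H"
proof -
  show "c \<noteq> 0"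
  proof
    assume "c = 0"
    then have "transition H t $ u $ v = 0" for u v using U[of u v] by simp
    \<comment> \<open>\<open>undefined\<close> serves as an arbitrary vertex: the zero matrix
      violates unitarity at every diagonal position.\<close>
    then show False using transition_unitary[of H t undefined undefined] by simp
  qed
  then show "t \<notin> scalar_times H"
    using scalar_timesD[of t H "p v" v for v] U[of "p v" v for v] p(2) by fastforce
  have "transition H t $ u $ w * transition H t $ w $ v = 0" if "u \<noteq> v" for u v w
    using U[of u w] U[of w v] p(1) that by (cases "u = p w \<and> w = p v") auto
  then show "t + t \<in> scalar_times H"
    unfolding scalar_times_def mem_Collect_eq transition_add_nth by (intro allI impI sum.neutral ballI) blast
qed

text \<open>The times at which \<open>transition H\<close> is diagonal form a cyclic group \<open>\<sigma>\<int>\<close>, and every time at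
  which it is a multiple of a fixed point free involution is congruent to \<open>\<sigma> / 2\<close>.\<close>
lemma pst_permutation_unique:
  assumes "pst_permutation H P" and "pgst_permutation_along H t Q"
  shows "Q = P"
proof -
  obtain p \<tau> \<gamma> where p: "P = perm_mat p" "\<And>v. p (p v) = v" "\<And>v. p v \<noteq> v"
    and \<tau>: "transition H \<tau> = scalar_mult \<gamma> P"
    using assms(1) unfolding pst_permutation_def order_two_fixed_point_free_iff by blast
  obtain q \<delta> where q: "Q = perm_mat q" "\<And>v. q (q v) = v" "\<And>v. q v \<noteq> v"
    and t: "(\<lambda>k. transition H (t k)) \<longlonglongrightarrow> scalar_mult \<delta> Q"
    using assms(2) unfolding pgst_permutation_along_def order_two_fixed_point_free_iff by blast
  have U\<tau>: "norm (transition H \<tau> $ u $ v) = norm \<gamma> * of_bool (u = p v)" for u v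
    by (simp add: \<tau> p(1) scalar_mult_perm_mat_nth)
  note \<tau>_time = permutation_time[OF U\<tau> p(2,3)]
  have "\<tau> + \<tau> \<noteq> 0" using \<tau>_time(2) zero_in_scalar_times by auto
  then obtain \<sigma> where \<sigma>: "\<sigma> > 0" "scalar_times H = range (\<lambda>n::int. of_int n * \<sigma>)"
    using closed_real_subgroup_cyclic[OF closed_scalar_times scalar_times_add scalar_times_minus
        \<tau>_time(3) _ \<tau>_time(2)] by blast
  \<comment> \<open>Twice \<open>x\<close> is \<open>n * \<sigma>\<close> with \<open>n\<close> odd,
    as \<open>x\<close> itself is not a scalar time. So \<open>x\<close> differs from
    \<open>\<sigma> / 2\<close> by a scalar time, and the moduli agree.\<close>
  have half: "norm (transition H (\<sigma> / 2) $ u $ v) = c * of_bool (u = r v)"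
    if U: "\<And>u v. norm (transition H x $ u $ v) = c * of_bool (u = r v)"
      and r: "\<And>v. r (r v) = v" "\<And>v. r v \<noteq> v" for x c r u v
  proof -
    note time = permutation_time[OF U r]
    obtain n :: int where n: "x + x = of_int n * \<sigma>" using time(3) \<sigma>(2) by auto
    have "odd n"
    proof
      assume "even n"
      then obtain m where "n = 2 * m" by (rule evenE)
      then have "x = of_int m * \<sigma>" using n by simp
      then show False using time(2) \<sigma>(2) by blast
    qed
    then obtain m where "n = 2 * m + 1" by (rule oddE)
    then have "x = of_int m * \<sigma> + \<sigma> / 2" using n by (simp add: field_simps)
    moreover have "of_int m * \<sigma> \<in> scalar_times H" using \<sigma>(2) by blast
    ultimately show ?thesis using norm_transition_shift[of "of_int m * \<sigma>" H "\<sigma> / 2"] U by simp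
  qed
  \<comment> \<open>The times \<open>t k\<close> may be unbounded. Reducing them modulo \<sigma>
    keeps all moduli and allows passing to a limit time \<open>x\<close>.\<close>
  define s where "s k = - (of_int \<lfloor>t k / \<sigma>\<rfloor> * \<sigma>) + t k" for k
  have "s k \<in> {0..\<sigma>}" for k
    using floor_divide_lower[OF \<sigma>(1), of "t k"] floor_divide_upper[OF \<sigma>(1), of "t k"]
    by (auto simp: s_def algebra_simps)
  then have "\<forall>k. s k \<in> {0..\<sigma>}" by blast
  moreover have "seq_compact {0..\<sigma>}"
    using compact_Icc compact_eq_seq_compact_metric by blast
  ultimately obtain x f where f: "strict_mono f" "(s \<circ> f) \<longlonglongrightarrow> x"
    by (metis seq_compactE)
  have "norm (transition H x $ u $ v) = norm \<delta> * of_bool (u = q v)" for u v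
  proof -
    have "- (of_int \<lfloor>t k / \<sigma>\<rfloor> * \<sigma>) \<in> scalar_times H" for k
      by (intro scalar_times_minus) (auto simp: \<sigma>(2))
    then have eq: "norm (transition H (s k) $ u $ v) = norm (transition H (t k) $ u $ v)" for k
      unfolding s_def by (rule norm_transition_shift)
    have "(\<lambda>k. norm (transition H (t k) $ u $ v)) \<longlonglongrightarrow> norm (scalar_mult \<delta> Q $ u $ v)"
      by (intro tendsto_intros t)
    then have "(\<lambda>k. norm (transition H (s (f k)) $ u $ v)) \<longlonglongrightarrow> norm (scalar_mult \<delta> Q $ u $ v)"
      using LIMSEQ_subseq_LIMSEQ[OF _ f(1)] unfolding eq by (force simp: o_def)
    moreover have "isCont (\<lambda>t. transition H t $ u $ v) x"
      using continuous_transition[of H u v] by (simp add: continuous_on_eq_continuous_at)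
    then have "(\<lambda>k. transition H (s (f k)) $ u $ v) \<longlonglongrightarrow> transition H x $ u $ v"
      using isCont_tendsto_compose f(2) unfolding o_def by blast
    then have "(\<lambda>k. norm (transition H (s (f k)) $ u $ v)) \<longlonglongrightarrow> norm (transition H x $ u $ v)"
      by (rule tendsto_norm)
    ultimately show ?thesis
      using LIMSEQ_unique by (fastforce simp: q(1) scalar_mult_perm_mat_nth norm_mult)
  qed
  note Ux = this
  \<comment> \<open>The moduli at time \<open>\<sigma> / 2\<close> are supported on the graph of
    \<open>p\<close> and also on that of \<open>q\<close>.\<close>
  have "q v = p v" for v
    using half[OF U\<tau> p(2,3), of "q v" v] half[OF Ux q(2,3), of "q v" v]
      permutation_time(1)[OF Ux q(2,3)] by (auto split: if_splits)
  then show ?thesis using p(1) q(1) by (simp add: perm_mat_eq_iff fun_eq_iff)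
qed

section \<open>Reduction of PST to PGST\<close>

lemma pst_imp_the_pgst_permutation:
  assumes "pst_permutation H P"
  shows "the_pgst_permutation H P"
proof -
  obtain p \<tau> \<gamma> where p: "P = perm_mat p" "\<And>v. p (p v) = v" "\<And>v. p v \<noteq> v"
    and \<tau>: "transition H \<tau> = scalar_mult \<gamma> (perm_mat p)"
    using assms unfolding pst_permutation_def order_two_fixed_point_free_iff by blast
  have "scalar_mult \<gamma> (perm_mat p) \<in> transition_closure H"
    using closure_subset[of "range (transition H)"] \<tau> by (metis rangeI subsetD)
  then show ?thesis
    unfolding the_pgst_permutation_def
    using pgst_permutation_of_closure p pst_permutation_unique[OF assms] by metis
qed

lemma pst_imp_pgst:
  assumes "pst H x y"
  shows "pgst H x y"
proof -
  obtain \<tau> \<gamma> where "transition H \<tau> *v cvec x = \<gamma> *s cvec y"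
    using assms by (auto simp: pst_def pst_at_def)
  then have "pgst_along H (\<lambda>_. \<tau>) x y"
    unfolding pgst_along_def by (intro exI[of _ \<gamma>]) simp
  then show ?thesis unfolding pgst_def by blast
qed

text \<open>The time of the vertex transfer works for every \<open>s\<close>, since the transition
  matrix is a multiple of \<open>P\<close> there.\<close>

lemma pst_pair_states:
  assumes "pst_permutation H P" and "axis c 1 = P *v axis a 1" "axis d 1 = P *v axis b 1"
  shows "pst H (pair_state a b s) (pair_state c d s)"
proof -
  obtain p \<tau> \<gamma> where p: "P = perm_mat p" and \<tau>: "transition H \<tau> = scalar_mult \<gamma> (perm_mat p)" "\<tau> > 0"
    using assms(1) unfolding pst_permutation_def order_two_fixed_point_free_iff vertex_pst_at_def pst_at_def
    by blast
  have "c = p a" "d = p b" using assms(2,3) by (simp_all add: p axis_eq_perm_mat_mult_iff)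
  then have "pst_at H \<tau> (pair_state a b s) (pair_state c d s)"
    unfolding pst_at_def using \<tau> scalar_mult_perm_mat_pair_state by metis
  then show ?thesis unfolding pst_def by blast
qed

lemma swap_imp_permuted:
  assumes "order_two_fixed_point_free P"
    and "axis b 1 = P *v axis a 1" and "(c, d) = (b, a)"
  shows "axis c 1 = P *v axis a 1 \<and> axis d 1 = P *v axis b 1"
  using assms by (auto simp: order_two_fixed_point_free_iff perm_mat_mult_axis axis_eq_axis)

(* The first two conjuncts are the PST and the PGST version. The third one covers connected
   graphs with vertex PGST whose associated permutation matrix depends on the sequence. *)
theorem theorem3:
  fixes H :: "'v::finite \<Rightarrow> 'v \<Rightarrow> bool"
    and P :: "real ^ 'v ^ 'v"
    and a b c d :: 'v
  assumes "simple_graph H" and "connected_graph H" and "in_association_scheme H"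
    and "a \<noteq> b" and "c \<noteq> d" and "(a, b) \<noteq> (c, d)"
  shows
    "(pst_permutation H P \<longrightarrow>
       ((\<forall>s. s \<noteq> 0 \<longrightarrow> pst H (pair_state a b s) (pair_state c d s)) \<longleftrightarrow>
        (axis c 1 = P *v axis a 1 \<and> axis d 1 = P *v axis b 1) \<or>
        (axis b 1 = P *v axis a 1 \<and> (c, d) = (b, a)))) \<and>
     (the_pgst_permutation H P \<longrightarrow>
       ((\<forall>s. s \<noteq> 0 \<longrightarrow> pgst H (pair_state a b s) (pair_state c d s)) \<longleftrightarrow>
        (axis c 1 = P *v axis a 1 \<and> axis d 1 = P *v axis b 1) \<or>
        (axis b 1 = P *v axis a 1 \<and> (c, d) = (b, a)))) \<and>
     ((\<exists>t. vertex_pgst_along H t) \<longrightarrow>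
       ((\<forall>s. s \<noteq> 0 \<longrightarrow> pgst H (pair_state a b s) (pair_state c d s)) \<longleftrightarrow>
        (\<exists>t Q. pgst_permutation_along H t Q \<and>
          ((axis c 1 = Q *v axis a 1 \<and> axis d 1 = Q *v axis b 1) \<or>
           (axis b 1 = Q *v axis a 1 \<and> (c, d) = (b, a))))))"
proof -
  obtain S where "association_scheme S" "adjacency H \<in> S"
    using assms(3) unfolding in_association_scheme_def by blast
  then interpret scheme_graph S H by unfold_locales
  let ?permuted = "\<lambda>P. axis c (1::real) = P *v axis a 1 \<and> axis d 1 = P *v axis b 1"
  have cases_iff: "?permuted P \<or> (axis b 1 = P *v axis a 1 \<and> (c, d) = (b, a)) \<longleftrightarrow> ?permuted P"
    if "order_two_fixed_point_free P" for P :: "real ^ 'v ^ 'v"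
    using swap_imp_permuted[OF that] by blast
  have pgst_iff: "(\<forall>s. s \<noteq> 0 \<longrightarrow> pgst H (pair_state a b s) (pair_state c d s)) \<longleftrightarrow>
      (\<exists>t Q. pgst_permutation_along H t Q \<and> ?permuted Q)"
    using pgst_pair_states_iff[OF assms(4-6)] .
  \<comment> \<open>Every admissible \<open>Q\<close> equals \<open>P\<close>, and some sequence
    yields \<open>P\<close>, so the existential collapses.\<close>
  have the_iff: "(\<forall>s. s \<noteq> 0 \<longrightarrow> pgst H (pair_state a b s) (pair_state c d s)) \<longleftrightarrow> ?permuted P"
    if "the_pgst_permutation H P"
    unfolding pgst_iff using that unfolding the_pgst_permutation_def by blast
  \<comment> \<open>Forward, PST for all \<open>s\<close> gives PGST for all \<open>s\<close>, and
    \<open>P\<close> is also the unique PGST permutation. Backward, the time of the vertex transfer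
    is used.\<close>
  have pst_iff: "(\<forall>s. s \<noteq> 0 \<longrightarrow> pst H (pair_state a b s) (pair_state c d s)) \<longleftrightarrow> ?permuted P"
    if "pst_permutation H P"
    using the_iff[OF pst_imp_the_pgst_permutation[OF that]] pst_imp_pgst pst_pair_states[OF that] by blast
  have "order_two_fixed_point_free P" if "pst_permutation H P"
    using that by (simp add: pst_permutation_def)
  moreover have "order_two_fixed_point_free P" if "the_pgst_permutation H P"
    using that by (auto simp: the_pgst_permutation_def pgst_permutation_along_def)
  moreover have "order_two_fixed_point_free Q" if "pgst_permutation_along H t Q" for t Q
    using that by (simp add: pgst_permutation_along_def)
  ultimately show ?thesis
    using cases_iff pst_iff the_iff pgst_iff by (smt (verit))
qed

end
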